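(* Let $\mathfrak g_{10}$ be the ten-dimensional real Lie algebra with basis $x,y,u_1,u_2,v_1,v_2,w_1,w_2,z_1,z_2$ whose non-zero brackets of basis vectors (up to skew-symmetry) are $$[x,u_i]=v_i,\quad [y,u_i]=w_i,\quad [u_i,v_i]=-z_2,\quad [u_i,w_i]=z_1\qquad(i=1,2),$$ and let $$\omega_o=x^*\wedge z_1^*+y^*\wedge z_2^*+u_1^*\wedge u_2^*+v_1^*\wedge w_1^*+v_2^*\wedge w_2^* ,$$ with respect to the dual basis; $(\mathfrak g_{10},\omega_o)$ is a three-step nilpotent symplectic Lie algebra. Then $(\mathfrak g_{10},\omega_o)$ has symplectic rank four. In particular, $(\mathfrak g_{10},\omega_o)$ has no Lagrangian ideal.
   Context: A symplectic Lie algebra $(\mathfrak g,\omega)$ is a Lie algebra with a non-degenerate alternating form $\omega$ satisfying $\omega([u,v],w)+\omega([w,u],v)+\omega([v,w],u)=0$. A subspace is isotropic if $\omega$ vanishes on it, and Lagrangian if it is isotropic of dimension $\frac12\dim\mathfrak g$. An isotropic (Lagrangian) ideal is an ideal that is an isotropic (Lagrangian) subspace. The symplectic rank of $(\mathfrak g,\omega)$ is the maximal dimension of an isotropic ideal. *)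

theory Defs
  imports "HOL-Analysis.Analysis"
begin

text \<open>Finite-dimensional real Lie algebras on a type of class \<open>euclidean_space\<close>. The class is only
  used to make the underlying vector space finite-dimensional; its inner product plays no role.\<close>

locale lie_algebra =
  fixes bracket :: "'a::euclidean_space \<Rightarrow> 'a \<Rightarrow> 'a"
  assumes bilinear_bracket: "bilinear bracket"
    and bracket_self: "bracket u u = 0"
    and jacobi:
      "bracket (bracket u v) w + bracket (bracket v w) u + bracket (bracket w u) v = 0"

locale symplectic_lie_algebra = lie_algebra bracket
  for bracket :: "'a::euclidean_space \<Rightarrow> 'a \<Rightarrow> 'a" +
  fixes \<omega> :: "'a \<Rightarrow> 'a \<Rightarrow> real"
  assumes bilinear_form: "bilinear \<omega>"
    and form_self: "\<omega> u u = 0"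
    and nondegenerate: "(\<And>v. \<omega> u v = 0) \<Longrightarrow> u = 0"
    and closed_form:
      "\<omega> (bracket u v) w + \<omega> (bracket w u) v + \<omega> (bracket v w) u = 0"

primrec lower_central_series ::
    "('a::euclidean_space \<Rightarrow> 'a \<Rightarrow> 'a) \<Rightarrow> nat \<Rightarrow> 'a set" where
  "lower_central_series bracket 0 = UNIV"
| "lower_central_series bracket (Suc k) =
     span {bracket a b | a b. b \<in> lower_central_series bracket k}"

definition step_nilpotent :: "nat \<Rightarrow> ('a::euclidean_space \<Rightarrow> 'a \<Rightarrow> 'a) \<Rightarrow> bool" where
  "step_nilpotent k bracket \<longleftrightarrow>
     lower_central_series bracket k = {0} \<and> (\<forall>j<k. lower_central_series bracket j \<noteq> {0})"

definition lie_ideal :: "('a::euclidean_space \<Rightarrow> 'a \<Rightarrow> 'a) \<Rightarrow> 'a set \<Rightarrow> bool" where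
  "lie_ideal bracket J \<longleftrightarrow> subspace J \<and> (\<forall>a. \<forall>b\<in>J. bracket a b \<in> J)"

definition isotropic :: "('a::euclidean_space \<Rightarrow> 'a \<Rightarrow> real) \<Rightarrow> 'a set \<Rightarrow> bool" where
  "isotropic \<omega> W \<longleftrightarrow> subspace W \<and> (\<forall>a\<in>W. \<forall>b\<in>W. \<omega> a b = 0)"

definition lagrangian :: "('a::euclidean_space \<Rightarrow> 'a \<Rightarrow> real) \<Rightarrow> 'a set \<Rightarrow> bool" where
  "lagrangian \<omega> W \<longleftrightarrow> isotropic \<omega> W \<and> 2 * dim W = DIM('a)"

text \<open>The maximum is over a set of naturals that contains \<open>dim {0}\<close> when the bracket and \<open>\<omega>\<close> are
  bilinear and that is bounded by the dimension of the whole space, so it is attained.\<close>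

definition symplectic_rank ::
    "('a::euclidean_space \<Rightarrow> 'a \<Rightarrow> 'a) \<Rightarrow> ('a \<Rightarrow> 'a \<Rightarrow> real) \<Rightarrow> nat" where
  "symplectic_rank bracket \<omega> = Max {dim J | J. lie_ideal bracket J \<and> isotropic \<omega> J}"

datatype g10_basis = X | Y | U1 | U2 | V1 | V2 | W1 | W2 | Z1 | Z2

lemma UNIV_g10_basis: "UNIV = {X, Y, U1, U2, V1, V2, W1, W2, Z1, Z2}"
  by (auto intro: g10_basis.exhaust)

instance g10_basis :: finite
  by standard (simp add: UNIV_g10_basis)

type_synonym g10 = "real ^ g10_basis"

text \<open>Each listed bracket of basis vectors in one order only; \<open>g10_bracket\<close> skew-symmetrises this
  table and extends it bilinearly.\<close>

fun g10_table :: "g10_basis \<Rightarrow> g10_basis \<Rightarrow> g10" where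
  "g10_table X U1 = axis V1 1"
| "g10_table X U2 = axis V2 1"
| "g10_table Y U1 = axis W1 1"
| "g10_table Y U2 = axis W2 1"
| "g10_table U1 V1 = - axis Z2 1"
| "g10_table U2 V2 = - axis Z2 1"
| "g10_table U1 W1 = axis Z1 1"
| "g10_table U2 W2 = axis Z1 1"
| "g10_table _ _ = 0"

definition g10_bracket :: "g10 \<Rightarrow> g10 \<Rightarrow> g10" where
  "g10_bracket a b =
     (\<Sum>p\<in>UNIV. \<Sum>q\<in>UNIV. (a $ p * b $ q) *\<^sub>R (g10_table p q - g10_table q p))"

text \<open>\<open>dual_wedge p q\<close> is $p^* \wedge q^*$ for the basis dual to the standard one, with the wedge of
  two covectors normalised without the factor $1/2$.\<close>

definition dual_wedge :: "g10_basis \<Rightarrow> g10_basis \<Rightarrow> g10 \<Rightarrow> g10 \<Rightarrow> real" where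
  "dual_wedge p q a b = a $ p * b $ q - b $ p * a $ q"

definition omega_o :: "g10 \<Rightarrow> g10 \<Rightarrow> real" where
  "omega_o a b = dual_wedge X Z1 a b + dual_wedge Y Z2 a b + dual_wedge U1 U2 a b
     + dual_wedge V1 W1 a b + dual_wedge V2 W2 a b"

end

theory Submission
  imports Defs
begin

text \<open>An isotropic ideal \<open>J\<close> has no \<open>u\<close>-components: for \<open>a \<in> J\<close> the elements \<open>[x, a]\<close> and \<open>[y, a]\<close>
  of \<open>J\<close> pair under \<open>\<omega>\<^sub>o\<close> to the sum of the squares of the two \<open>u\<close>-coordinates of \<open>a\<close>. Hence \<open>u\<^sub>1\<close> is
  \<open>\<omega>\<^sub>o\<close>-orthogonal to \<open>J\<close> without lying in it, so that \<open>J + \<real>u\<^sub>1\<close> is again isotropic; its dimension is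
  at most five, and therefore \<open>dim J \<le> 4\<close>. The span of \<open>v\<^sub>1, v\<^sub>2, z\<^sub>1, z\<^sub>2\<close> attains this bound.\<close>

text \<open>The inner product turns \<open>\<omega>\<close> into a linear map \<open>T\<close>.
  Nondegeneracy makes \<open>T\<close> injective, and isotropy sends \<open>W\<close> into its
  orthogonal complement, so \<open>dim W\<close> is at most the codimension of
  \<open>W\<close>.\<close>

lemma dim_isotropic_le:
  fixes \<omega> :: "'a::euclidean_space \<Rightarrow> 'a \<Rightarrow> real"
  assumes bil: "bilinear \<omega>" and nondeg: "\<And>u. (\<And>v. \<omega> u v = 0) \<Longrightarrow> u = 0"
    and iso: "isotropic \<omega> W"
  shows "2 * dim W \<le> DIM('a)"
proof -
  define T where "T a = (\<Sum>i\<in>Basis. \<omega> a i *\<^sub>R i)" for a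
  have T: "T a \<bullet> b = \<omega> a b" for a b
  proof -
    have "linear (\<omega> a)"
      using bil by (simp add: bilinear_def)
    then have "\<omega> a b = (\<Sum>i\<in>Basis. (b \<bullet> i) * \<omega> a i)"
      by (subst euclidean_representation[of b, symmetric])
        (simp add: linear_sum linear_cmul del: euclidean_representation)
    then show ?thesis
      by (simp add: T_def inner_sum_left inner_commute[of b] mult.commute)
  qed
  have lin: "linear T"
    by (rule linearI)
      (simp_all add: T_def bilinear_ladd[OF bil] bilinear_lmul[OF bil] scaleR_add_left
        sum.distrib scaleR_sum_right)
  have "a = 0" if "T a = 0" for a
    using nondeg T[of a] that by simp
  then have "inj T"
    using lin by (simp add: linear_injective_0)
  then have "dim (T ` W) = dim W"
    using lin by (simp add: dim_image_eq inj_on_subset)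
  moreover have "T ` W \<subseteq> W\<^sup>\<bottom>"
    using iso T by (auto simp: isotropic_def orthogonal_comp_def orthogonal_def inner_commute)
  moreover have "dim (W\<^sup>\<bottom>) + dim W = DIM('a)"
    using dim_subspace_orthogonal_to_vectors[of W UNIV] iso
    by (simp add: isotropic_def orthogonal_comp_def)
  ultimately show ?thesis
    using dim_subset[of "T ` W" "W\<^sup>\<bottom>"] by linarith
qed

lemma isotropic_add_vector:
  assumes bil: "bilinear \<omega>" and alt: "\<And>u. \<omega> u u = 0"
    and iso: "isotropic \<omega> W" and orth: "\<And>a. a \<in> W \<Longrightarrow> \<omega> u a = 0" "\<And>a. a \<in> W \<Longrightarrow> \<omega> a u = 0"
  shows "isotropic \<omega> (span (insert u W))"
proof -
  have W: "span W = W"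
    using iso by (simp add: isotropic_def span_eq_iff)
  have "\<omega> a b = 0" if ab: "a \<in> span (insert u W)" "b \<in> span (insert u W)" for a b
  proof -
    obtain k l where k: "a - k *\<^sub>R u \<in> W" and l: "b - l *\<^sub>R u \<in> W"
      using ab by (auto simp: span_insert W)
    \<comment> \<open>Splitting both arguments along \<open>u\<close> and \<open>W\<close> gives
      four terms: the \<open>u\<close>-\<open>u\<close> term vanishes by \<open>alt\<close>, the
      mixed ones by \<open>orth\<close>, the last by isotropy of \<open>W\<close>.\<close>
    have "\<omega> (k *\<^sub>R u + (a - k *\<^sub>R u)) (l *\<^sub>R u + (b - l *\<^sub>R u)) = 0"
      using iso k l
      unfolding bilinear_ladd[OF bil] bilinear_radd[OF bil] bilinear_lmul[OF bil]
        bilinear_rmul[OF bil]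
      by (simp add: alt orth isotropic_def)
    then show ?thesis
      by simp
  qed
  then show ?thesis
    by (simp add: isotropic_def)
qed

lemma all_g10_basis:
  "(\<forall>i. P i) \<longleftrightarrow> P X \<and> P Y \<and> P U1 \<and> P U2 \<and> P V1 \<and> P V2 \<and> P W1 \<and> P W2 \<and> P Z1 \<and> P Z2"
  by (metis g10_basis.exhaust)

text \<open>With the bracket in coordinates, the Lie algebra axioms become polynomial identities for
  the simplifier.\<close>

lemma g10_bracket_nth [simp]:
  "g10_bracket a b $ X = 0"
  "g10_bracket a b $ Y = 0"
  "g10_bracket a b $ U1 = 0"
  "g10_bracket a b $ U2 = 0"
  "g10_bracket a b $ V1 = a $ X * b $ U1 - a $ U1 * b $ X"
  "g10_bracket a b $ V2 = a $ X * b $ U2 - a $ U2 * b $ X"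
  "g10_bracket a b $ W1 = a $ Y * b $ U1 - a $ U1 * b $ Y"
  "g10_bracket a b $ W2 = a $ Y * b $ U2 - a $ U2 * b $ Y"
  "g10_bracket a b $ Z1 = a $ U1 * b $ W1 - a $ W1 * b $ U1 + a $ U2 * b $ W2 - a $ W2 * b $ U2"
  "g10_bracket a b $ Z2 = a $ V1 * b $ U1 - a $ U1 * b $ V1 + a $ V2 * b $ U2 - a $ U2 * b $ V2"
  by (simp_all add: g10_bracket_def UNIV_g10_basis axis_def)

lemma omega_o_expand:
  "omega_o a b = a $ X * b $ Z1 - b $ X * a $ Z1 + (a $ Y * b $ Z2 - b $ Y * a $ Z2)
     + (a $ U1 * b $ U2 - b $ U1 * a $ U2) + (a $ V1 * b $ W1 - b $ V1 * a $ W1)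
     + (a $ V2 * b $ W2 - b $ V2 * a $ W2)"
  by (simp add: omega_o_def dual_wedge_def)

lemma bilinear_omega_o: "bilinear omega_o"
  by (auto simp: bilinear_def omega_o_expand algebra_simps intro!: linearI)

lemma omega_o_self: "omega_o a a = 0"
  by (simp add: omega_o_expand)

lemma omega_o_nondegenerate:
  assumes "\<And>b. omega_o a b = 0"
  shows "a = 0"
proof -
  \<comment> \<open>Each basis vector has exactly one partner under \<open>omega_o\<close>, so these
    ten values are the coordinates of \<open>a\<close> up to sign.\<close>
  have "omega_o a (axis i 1) = 0" for i
    by (rule assms)
  from this[of X] this[of Y] this[of U1] this[of U2] this[of V1] this[of V2] this[of W1]
    this[of W2] this[of Z1] this[of Z2]
  show ?thesis
    by (simp add: omega_o_expand axis_def vec_eq_iff all_g10_basis)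
qed

lemma symplectic_lie_algebra_g10: "symplectic_lie_algebra g10_bracket omega_o"
proof
  show "bilinear g10_bracket"
    by (auto simp: bilinear_def vec_eq_iff all_g10_basis algebra_simps intro!: linearI)
  show "g10_bracket a a = 0" for a
    by (simp add: vec_eq_iff all_g10_basis)
  show "g10_bracket (g10_bracket a b) c + g10_bracket (g10_bracket b c) a
      + g10_bracket (g10_bracket c a) b = 0" for a b c
    by (simp add: vec_eq_iff all_g10_basis algebra_simps)
  show "omega_o (g10_bracket a b) c + omega_o (g10_bracket c a) b
      + omega_o (g10_bracket b c) a = 0" for a b c
    by (simp add: omega_o_expand algebra_simps)
qed (fact bilinear_omega_o omega_o_self omega_o_nondegenerate)+

lemma step_nilpotent_g10: "step_nilpotent 3 g10_bracket"
proof -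
  let ?L = "lower_central_series g10_bracket"
  \<comment> \<open>Coordinate subspaces bound the series from above: brackets lie in the span of
    the \<open>v\<close>, \<open>w\<close> and \<open>z\<close> vectors, bracketing with these
    leaves only \<open>z\<close> vectors, and those are central.\<close>
  let ?S = "\<lambda>d. {a :: g10. \<forall>i. i \<notin> d \<longrightarrow> a $ i = 0}"
  have Suc_subset: "?L (Suc k) \<subseteq> ?S d"
    if "\<And>a b. b \<in> ?L k \<Longrightarrow> g10_bracket a b \<in> ?S d" for k d
  proof -
    have "subspace (?S d)"
      by (auto simp: subspace_def)
    then show ?thesis
      using that unfolding lower_central_series.simps by (intro span_minimal) blast+
  qed
  have Suc_mem: "g10_bracket a b \<in> ?L (Suc k)" if "b \<in> ?L k" for a b k
    using that by (auto intro: span_base)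
  have L1: "?L (Suc 0) \<subseteq> ?S {V1, V2, W1, W2, Z1, Z2}"
    by (rule Suc_subset) (simp add: all_g10_basis)
  have "g10_bracket a b \<in> ?S {Z1, Z2}" if "b \<in> ?L (Suc 0)" for a b
    using subsetD[OF L1 that] by (simp add: all_g10_basis)
  then have L2: "?L (Suc (Suc 0)) \<subseteq> ?S {Z1, Z2}"
    by (rule Suc_subset)
  have "g10_bracket a b \<in> ?S {}" if "b \<in> ?L (Suc (Suc 0))" for a b
    using subsetD[OF L2 that] by (simp add: all_g10_basis)
  then have "?L (Suc (Suc (Suc 0))) \<subseteq> ?S {}"
    by (rule Suc_subset)
  then have "?L 3 \<subseteq> {0}"
    by (auto simp: numeral_3_eq_3 vec_eq_iff)
  moreover have "0 \<in> ?L 3"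
    by (simp add: numeral_3_eq_3 span_zero)
  moreover have "?L j \<noteq> {0}" if "j < 3" for j
  proof -
    \<comment> \<open>The iterated bracket \<open>[u1, [x, u1]] = [u1, v1] = -z2\<close> shows that
      the series does not vanish earlier.\<close>
    let ?b = "g10_bracket (axis X 1) (axis U1 1)"
    let ?c = "g10_bracket (axis U1 1) ?b"
    have b: "?b \<in> ?L (Suc 0)"
      by (rule Suc_mem) simp
    then have "?c \<in> ?L (Suc (Suc 0))"
      by (rule Suc_mem)
    moreover have "?b $ V1 = 1" "?c $ Z2 = -1"
      by (simp_all add: axis_def)
    ultimately have "?L (Suc 0) \<noteq> {0}" "?L (Suc (Suc 0)) \<noteq> {0}"
      using b by (metis singletonD zero_index zero_neq_one zero_neq_neg_one)+
    moreover have "?L 0 \<noteq> {0}"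
      using UNIV_not_singleton by auto
    moreover have "j = 0 \<or> j = Suc 0 \<or> j = Suc (Suc 0)"
      using that by auto
    ultimately show ?thesis
      by metis
  qed
  ultimately show ?thesis
    by (auto simp: step_nilpotent_def)
qed

lemma isotropic_ideal_U_zero:
  assumes ideal: "lie_ideal g10_bracket J" and iso: "isotropic omega_o J" and a: "a \<in> J"
  shows "a $ U1 = 0" "a $ U2 = 0"
proof -
  have "omega_o (g10_bracket (axis X 1) a) (g10_bracket (axis Y 1) a) = 0"
    using assms by (simp add: lie_ideal_def isotropic_def)
  \<comment> \<open>The two brackets are \<open>(a $ U1) v1 + (a $ U2) v2\<close> and
    \<open>(a $ U1) w1 + (a $ U2) w2\<close>, and \<open>omega_o\<close> pairs \<open>vi\<close>
    with \<open>wi\<close> to 1. Over the reals a vanishing sum of squares has zero terms.\<close>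
  then have "(a $ U1)\<^sup>2 + (a $ U2)\<^sup>2 = 0"
    by (simp add: omega_o_expand axis_def power2_eq_square)
  then show "a $ U1 = 0" "a $ U2 = 0"
    by (simp_all add: sum_power2_eq_zero_iff)
qed

lemma dim_isotropic_ideal_le:
  assumes ideal: "lie_ideal g10_bracket J" and iso: "isotropic omega_o J"
  shows "dim J \<le> 4"
proof -
  let ?u = "axis U1 1 :: g10"
  note U = isotropic_ideal_U_zero[OF ideal iso]
  have J: "span J = J"
    using iso by (simp add: isotropic_def span_eq_iff)
  have "?u \<notin> J"
    using U(1)[of ?u] by auto
  then have dim: "dim (span (insert ?u J)) = dim J + 1"
    by (simp add: dim_insert J)
  \<comment> \<open>The partner of \<open>u1\<close> is \<open>u2\<close>, so orthogonality comes
    from the \<open>U2\<close> coordinate, whereas \<open>?u \<notin> J\<close> came from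
    \<open>U1\<close>.\<close>
  have "omega_o ?u a = 0" "omega_o a ?u = 0" if "a \<in> J" for a
    using U[OF that] by (simp_all add: omega_o_expand axis_def)
  then have "isotropic omega_o (span (insert ?u J))"
    by (intro isotropic_add_vector bilinear_omega_o omega_o_self iso)
  then have "2 * dim (span (insert ?u J)) \<le> DIM(g10)"
    by (intro dim_isotropic_le[of omega_o] bilinear_omega_o omega_o_nondegenerate)
  also have "DIM(g10) = 10"
    by (simp add: UNIV_g10_basis)
  finally show ?thesis
    using dim by simp
qed

lemma four_dim_isotropic_ideal:
  "\<exists>J. lie_ideal g10_bracket J \<and> isotropic omega_o J \<and> dim J = 4"
proof -
  let ?J = "{a :: g10. \<forall>i. i \<notin> {V1, V2, Z1, Z2} \<longrightarrow> a $ i = 0}"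
  have "subspace ?J"
    by (auto simp: subspace_def)
  \<comment> \<open>Brackets with \<open>v1\<close> and \<open>v2\<close> are multiples of
    \<open>z2\<close>, and no two of the four chosen basis vectors are partners under
    \<open>omega_o\<close>.\<close>
  then have "lie_ideal g10_bracket ?J" "isotropic omega_o ?J"
    by (simp_all add: lie_ideal_def isotropic_def omega_o_expand all_g10_basis)
  moreover have "dim ?J = 4"
    using dim_substandard_cart[where 'a = real, of "{V1, V2, Z1, Z2}"] by (simp add: dim_vec_eq)
  ultimately show ?thesis
    by blast
qed

theorem proposition9p4:
  shows "symplectic_lie_algebra g10_bracket omega_o \<and>
    step_nilpotent 3 g10_bracket \<and>
    symplectic_rank g10_bracket omega_o = 4 \<and>
    \<not> (\<exists>J. lie_ideal g10_bracket J \<and> lagrangian omega_o J)"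
proof (intro conjI)
  let ?D = "{dim J | J. lie_ideal g10_bracket J \<and> isotropic omega_o J}"
  have le: "n \<le> 4" if "n \<in> ?D" for n
    using that dim_isotropic_ideal_le by auto
  \<comment> \<open>\<open>Max\<close> is meaningful only on a finite nonempty set; the bound 4
    supplies finiteness.\<close>
  then have "finite ?D"
    by (meson finite_nat_set_iff_bounded_le)
  moreover have "4 \<in> ?D"
    using four_dim_isotropic_ideal by force
  ultimately show "symplectic_rank g10_bracket omega_o = 4"
    unfolding symplectic_rank_def by (intro Max_eqI le)
  have "DIM(g10) = 10"
    by (simp add: UNIV_g10_basis)
  \<comment> \<open>A Lagrangian ideal would be an isotropic ideal of dimension 5.\<close>
  then show "\<not> (\<exists>J. lie_ideal g10_bracket J \<and> lagrangian omega_o J)"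
    using dim_isotropic_ideal_le by (fastforce simp: lagrangian_def)
qed (fact symplectic_lie_algebra_g10 step_nilpotent_g10)+

end
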